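(* Let $G=P_2\square P_m$ be the ladder graph with $m\ge 2$. Let $(a_i)_{i=1}^m$ and $(b_i)_{i=1}^m$ be sequences of positive integers, and set $a_0=b_0=a_{m+1}=b_{m+1}=0$. Suppose that for all $i=1,\dots,m$, $$a_i\mid (a_{i-1}+a_{i+1}+b_i),\qquad b_i\mid (b_{i-1}+b_{i+1}+a_i).$$ Define $$d_{1,i}=\frac{a_{i-1}+a_{i+1}+b_i}{a_i},\qquad d_{2,i}=\frac{b_{i-1}+b_{i+1}+a_i}{b_i},$$ and, with the vertices of $G$ ordered as $(1,1),\dots,(1,m),(2,1),\dots,(2,m)$, let $$\mathbf r=(a_1,\dots,a_m,b_1,\dots,b_m),\qquad \mathbf d=(d_{1,1},\dots,d_{1,m},d_{2,1},\dots,d_{2,m}).$$ If $\mathbf r$ is primitive, then $(\mathbf d,\mathbf r)$ is an arithmetical structure on $G$, i.e. $\operatorname{diag}(\mathbf d)\mathbf r=A(G)\mathbf r$. Moreover, if $(a_1,\dots,a_m)\neq(b_1,\dots,b_m)$, then the structure is non-symmetric.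
   Context: An arithmetical structure on a finite connected graph $G$ is a pair $(\mathbf d,\mathbf r)$ of vectors of positive integers indexed by the vertices of $G$ such that $\mathbf r$ is primitive (the gcd of its entries is $1$) and $(\operatorname{diag}(\mathbf d)-A(G))\mathbf r=0$, where $A(G)$ is the adjacency matrix of $G$. $P_n$ is the path graph with vertex set $\{1,\dots,n\}$ and edges $\{i,i+1\}$, $1\le i<n$. The Cartesian product $G_1\square G_2$ has vertex set $V(G_1)\times V(G_2)$, with $(u_1,v_1)$ adjacent to $(u_2,v_2)$ iff ($u_1=u_2$ and $v_1v_2\in E(G_2)$) or ($v_1=v_2$ and $u_1u_2\in E(G_1)$). An arithmetical structure $(\mathbf d,\mathbf r)$ on $P_2\square P_m$ is symmetric if the entries of $\mathbf r$ satisfy $r(1,i)=r(2,i)$ for all $i=1,\dots,m$, and non-symmetric otherwise. *)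

theory Defs
  imports "Graph_Theory.Digraph_Component"
begin

text \<open>
  A simple graph is a symmetric loop-free digraph without multiple arcs (locale
  \<^locale>\<open>pair_graph\<close>): an edge \<open>{u, v}\<close> is the pair of arcs \<open>(u, v)\<close> and \<open>(v, u)\<close>.
\<close>

definition path_graph :: "nat \<Rightarrow> nat pair_pre_digraph" where
  "path_graph n =
     \<lparr> pverts = {1..n},
       parcs = {(i, j). i \<in> {1..n} \<and> j \<in> {1..n} \<and> (j = i + 1 \<or> i = j + 1)} \<rparr>"

definition cartesian_product ::
    "'a pair_pre_digraph \<Rightarrow> 'b pair_pre_digraph \<Rightarrow> ('a \<times> 'b) pair_pre_digraph"
    (infixr \<open>\<box>\<^sub>G\<close> 70) where
  "G1 \<box>\<^sub>G G2 =
     \<lparr> pverts = pverts G1 \<times> pverts G2,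
       parcs = {((u1, v1), (u2, v2)).
         (u1, v1) \<in> pverts G1 \<times> pverts G2 \<and> (u2, v2) \<in> pverts G1 \<times> pverts G2 \<and>
         (u1 = u2 \<and> (v1, v2) \<in> parcs G2 \<or> v1 = v2 \<and> (u1, u2) \<in> parcs G1)} \<rparr>"

text \<open>
  Vectors and square matrices indexed by the vertices of \<open>G\<close> are functions on the vertex
  type; only their values on \<^term>\<open>pverts G\<close> are meaningful.
\<close>

definition adjacency_matrix :: "'a pair_pre_digraph \<Rightarrow> 'a \<Rightarrow> 'a \<Rightarrow> int" where
  "adjacency_matrix G u v = (if (u, v) \<in> parcs G then 1 else 0)"

definition diag_matrix :: "('a \<Rightarrow> int) \<Rightarrow> 'a \<Rightarrow> 'a \<Rightarrow> int" where
  "diag_matrix d u v = (if u = v then d u else 0)"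

definition mat_vec_on :: "'a set \<Rightarrow> ('a \<Rightarrow> 'a \<Rightarrow> int) \<Rightarrow> ('a \<Rightarrow> int) \<Rightarrow> 'a \<Rightarrow> int" where
  "mat_vec_on V M x u = (\<Sum>v\<in>V. M u v * x v)"

definition primitive_on :: "'a set \<Rightarrow> ('a \<Rightarrow> int) \<Rightarrow> bool" where
  "primitive_on V r \<longleftrightarrow> Gcd (r ` V) = 1"

definition arithmetical_structure ::
    "'a pair_pre_digraph \<Rightarrow> ('a \<Rightarrow> int) \<Rightarrow> ('a \<Rightarrow> int) \<Rightarrow> bool" where
  "arithmetical_structure G d r \<longleftrightarrow>
     pair_graph G \<and> connected (with_proj G) \<and>
     (\<forall>v\<in>pverts G. d v > 0 \<and> r v > 0) \<and>
     primitive_on (pverts G) r \<and>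
     (\<forall>u\<in>pverts G.
        mat_vec_on (pverts G) (\<lambda>v w. diag_matrix d v w - adjacency_matrix G v w) r u = 0)"

definition ladder :: "nat \<Rightarrow> (nat \<times> nat) pair_pre_digraph" where
  "ladder m = path_graph 2 \<box>\<^sub>G path_graph m"

definition symmetric_structure ::
    "nat \<Rightarrow> (nat \<times> nat \<Rightarrow> int) \<Rightarrow> (nat \<times> nat \<Rightarrow> int) \<Rightarrow> bool" where
  "symmetric_structure m d r \<longleftrightarrow>
     arithmetical_structure (ladder m) d r \<and> (\<forall>i\<in>{1..m}. r (1, i) = r (2, i))"

definition nonsymmetric_structure ::
    "nat \<Rightarrow> (nat \<times> nat \<Rightarrow> int) \<Rightarrow> (nat \<times> nat \<Rightarrow> int) \<Rightarrow> bool" where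
  "nonsymmetric_structure m d r \<longleftrightarrow>
     arithmetical_structure (ladder m) d r \<and> \<not> symmetric_structure m d r"

text \<open>The vertex order \<open>(1,1), \<dots>, (1,m), (2,1), \<dots>, (2,m)\<close>.\<close>

definition ladder_order :: "nat \<Rightarrow> (nat \<times> nat) list" where
  "ladder_order m = List.product [1, 2] [1..<m + 1]"

text \<open>
  The vertex-indexed vector whose coordinates, in the vertex order \<open>vs\<close>, are the entries of
  \<open>xs\<close>. It is meant for distinct \<open>vs\<close> of the same length as \<open>xs\<close>, and is unspecified
  outside \<^term>\<open>set vs\<close>.
\<close>

definition vector_in_order :: "'a list \<Rightarrow> int list \<Rightarrow> 'a \<Rightarrow> int" where
  "vector_in_order vs xs v = the (map_of (zip vs xs) v)"

end

theory Submission
  imports Defs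
begin

text \<open>
  The divisibility hypotheses say exactly that every entry of \<open>r\<close> divides the sum of the
  entries at the neighbouring vertices, and \<open>d\<close> collects the quotients; so
  \<open>diag(d) r = A r\<close> holds row by row as soon as the rows of \<open>A r\<close> are known. These rows come
  from the product structure: away from loops, the adjacency matrix of a Cartesian product is
  the Kronecker sum of the adjacency matrices of the factors
  (\<open>mat_vec_on_adjacency_cartesian_product\<close>), so the entry of \<open>A r\<close> at \<open>(k, i)\<close> is the sum of
  the horizontal neighbours, given by the path \<open>P\<^sub>m\<close>, and of the other entry of the same rung,
  given by \<open>P\<^sub>2\<close>. The boundary values \<open>a\<^sub>0 = a\<^sub>m\<^sub>+\<^sub>1 = 0\<close> (and the same for \<open>b\<close>) account for the
  neighbours missing at the two ends of the ladder.

  The quotients are positive since each numerator is the positive entry across the rung plus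
  two nonnegative terms.
  That the ladder is a connected simple graph is also a matter of the factors: both properties
  hold for nonempty paths and pass to Cartesian products.

  The structure is symmetric only if \<open>a\<close> and \<open>b\<close> agree on \<open>{1..m}\<close>, because the
  coordinates of \<open>r\<close> at \<open>(1, i)\<close> and \<open>(2, i)\<close> are \<open>a i\<close> and \<open>b i\<close>.
\<close>

section \<open>Connected simple graphs and Cartesian products\<close>

text \<open>
  Connectedness refers to the symmetric closure of the arc set, which for a simple graph is
  the arc set itself; this makes walks in the graph available for proving it connected.
\<close>

lemma (in pair_graph) connected_iff_strongly_connected:
  "connected (with_proj G) \<longleftrightarrow> strongly_connected (with_proj G)"
  using reachable_mk_symmetric_eq[OF pair_sym_arcs]
  by (auto simp: connected_def strongly_connected_def)

lemma pair_graph_path_graph: "pair_graph (path_graph n)"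
proof unfold_locales
  show "finite (parcs (path_graph n))"
    by (rule finite_subset[of _ "{1..n} \<times> {1..n}"]) (auto simp: path_graph_def)
qed (auto simp: path_graph_def symmetric_def intro!: symI)

lemma pair_graph_cartesian_product:
  assumes "pair_graph G1" "pair_graph G2"
  shows "pair_graph (G1 \<box>\<^sub>G G2)"
proof -
  interpret G1: pair_graph G1 by fact
  interpret G2: pair_graph G2 by fact
  let ?V = "pverts G1 \<times> pverts G2"
  show ?thesis
  proof unfold_locales
    show "finite (parcs (G1 \<box>\<^sub>G G2))"
      by (rule finite_subset[of _ "?V \<times> ?V"])
        (auto simp: cartesian_product_def G1.pair_finite_verts G2.pair_finite_verts)
    show "symmetric (with_proj (G1 \<box>\<^sub>G G2))"
      using G1.pair_sym_arcs G2.pair_sym_arcs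
      by (auto simp: cartesian_product_def symmetric_def sym_def)
  qed (auto simp: cartesian_product_def G1.pair_finite_verts G2.pair_finite_verts
        dest: G1.pair_no_loops G2.pair_no_loops)
qed

lemma strongly_connected_path_graph:
  assumes "n \<ge> 1"
  shows "strongly_connected (with_proj (path_graph n))"
proof -
  interpret pair_graph "path_graph n" by (rule pair_graph_path_graph)
  have from_1: "1 \<rightarrow>\<^sup>*\<^bsub>with_proj (path_graph n)\<^esub> i" if "1 \<le> i" "i \<le> n" for i
    using that
  proof (induction i rule: dec_induct)
    case base
    show ?case using assms by (intro reachable_refl) (simp add: path_graph_def)
  next
    case (step i)
    then have "(i, Suc i) \<in> parcs (path_graph n)" by (auto simp: path_graph_def)
    with step show ?case by (auto intro: reachable_adj_trans)
  qed
  show ?thesis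
  proof (rule strongly_connectedI)
    fix u v assume "u \<in> verts (with_proj (path_graph n))" "v \<in> verts (with_proj (path_graph n))"
    then have "1 \<le> u" "u \<le> n" "1 \<le> v" "v \<le> n" by (simp_all add: path_graph_def)
    then have "1 \<rightarrow>\<^sup>*\<^bsub>with_proj (path_graph n)\<^esub> u" "1 \<rightarrow>\<^sup>*\<^bsub>with_proj (path_graph n)\<^esub> v"
      by (auto intro: from_1 simp del: One_nat_def)
    then show "u \<rightarrow>\<^sup>*\<^bsub>with_proj (path_graph n)\<^esub> v"
      by (meson reachable_trans symmetric_reachable')
  qed (use assms in \<open>auto simp: path_graph_def\<close>)
qed

text \<open>
  A walk from \<open>(u, w)\<close> to \<open>(u', w')\<close> first moves inside the copy of the first factor over \<open>w\<close>
  and then inside the copy of the second factor over \<open>u'\<close>.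
\<close>

lemma strongly_connected_cartesian_product:
  assumes "strongly_connected (with_proj G1)" "strongly_connected (with_proj G2)"
  shows "strongly_connected (with_proj (G1 \<box>\<^sub>G G2))"
proof -
  let ?V = "pverts G1 \<times> pverts G2"
  let ?R = "rtrancl_on ?V (parcs (G1 \<box>\<^sub>G G2))"
  have move1: "((u, w), (u', w)) \<in> ?R"
    if "(u, u') \<in> rtrancl_on (pverts G1) (parcs G1)" "w \<in> pverts G2" for u u' w
    using that(1)
  proof (induction rule: rtrancl_on_induct)
    case (step x y)
    with that(2) have "((x, w), (y, w)) \<in> parcs (G1 \<box>\<^sub>G G2)"
      by (auto simp: cartesian_product_def dest: in_rtrancl_on_in_F)
    with step that(2) show ?case by (blast intro: rtrancl_on_into_rtrancl_on)
  qed (use that(2) in auto)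
  have move2: "((u, w), (u, w')) \<in> ?R"
    if "(w, w') \<in> rtrancl_on (pverts G2) (parcs G2)" "u \<in> pverts G1" for u w w'
    using that(1)
  proof (induction rule: rtrancl_on_induct)
    case (step x y)
    with that(2) have "((u, x), (u, y)) \<in> parcs (G1 \<box>\<^sub>G G2)"
      by (auto simp: cartesian_product_def dest: in_rtrancl_on_in_F)
    with step that(2) show ?case by (blast intro: rtrancl_on_into_rtrancl_on)
  qed (use that(2) in auto)
  have "((u, w), (u', w')) \<in> ?R"
    if "u \<in> pverts G1" "u' \<in> pverts G1" "w \<in> pverts G2" "w' \<in> pverts G2" for u u' w w'
    using assms that by (intro rtrancl_on_trans[OF move1 move2])
      (auto simp: strongly_connected_def reachable_def)
  with assms show ?thesis
    by (auto simp: strongly_connected_def reachable_def cartesian_product_def)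
qed

section \<open>Matrix-vector products\<close>

lemma mat_vec_on_diag:
  assumes "finite V" "u \<in> V"
  shows "mat_vec_on V (diag_matrix d) x u = d u * x u"
proof -
  have "mat_vec_on V (diag_matrix d) x u = (\<Sum>v\<in>V. if u = v then d u * x u else 0)"
    unfolding mat_vec_on_def diag_matrix_def by (rule sum.cong) auto
  then show ?thesis using assms by simp
qed

lemma mat_vec_on_diff:
  "mat_vec_on V (\<lambda>v w. M v w - N v w) x u = mat_vec_on V M x u - mat_vec_on V N x u"
  by (simp add: mat_vec_on_def left_diff_distrib sum_subtractf)

text \<open>
  The identity \<open>A(G\<^sub>1 \<box> G\<^sub>2) = I \<otimes> A(G\<^sub>2) + A(G\<^sub>1) \<otimes> I\<close>, applied to a vector. Without loops no
  arc of the product is both a copy of an arc of \<open>G\<^sub>1\<close> and a copy of an arc of \<open>G\<^sub>2\<close>, so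
  nothing is counted twice.
\<close>

lemma mat_vec_on_adjacency_cartesian_product:
  assumes "pair_graph G1" "pair_graph G2" and u: "u \<in> pverts G1" and w: "w \<in> pverts G2"
  shows "mat_vec_on (pverts (G1 \<box>\<^sub>G G2)) (adjacency_matrix (G1 \<box>\<^sub>G G2)) x (u, w) =
    mat_vec_on (pverts G2) (adjacency_matrix G2) (\<lambda>w'. x (u, w')) w +
    mat_vec_on (pverts G1) (adjacency_matrix G1) (\<lambda>u'. x (u', w)) u"
proof -
  interpret G1: pair_graph G1 by fact
  interpret G2: pair_graph G2 by fact
  note fin = G1.pair_finite_verts G2.pair_finite_verts
  let ?A1 = "adjacency_matrix G1" and ?A2 = "adjacency_matrix G2"
  have entry: "adjacency_matrix (G1 \<box>\<^sub>G G2) (u, w) (u', w') =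
      (if u = u' then ?A2 w w' else 0) + (if w = w' then ?A1 u u' else 0)"
    if "u' \<in> pverts G1" "w' \<in> pverts G2" for u' w'
    using that u w
    by (auto simp: adjacency_matrix_def cartesian_product_def
        dest: G1.pair_no_loops G2.pair_no_loops)
  have "mat_vec_on (pverts (G1 \<box>\<^sub>G G2)) (adjacency_matrix (G1 \<box>\<^sub>G G2)) x (u, w) =
      (\<Sum>u'\<in>pverts G1. \<Sum>w'\<in>pverts G2.
        adjacency_matrix (G1 \<box>\<^sub>G G2) (u, w) (u', w') * x (u', w'))"
    by (simp add: mat_vec_on_def cartesian_product_def sum.cartesian_product)
  also have "\<dots> = (\<Sum>u'\<in>pverts G1. \<Sum>w'\<in>pverts G2.
      (if u = u' then ?A2 w w' * x (u, w') else 0) +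
      (if w = w' then ?A1 u u' * x (u', w) else 0))"
    by (intro sum.cong refl) (auto simp: entry distrib_right)
  also have "\<dots> = (\<Sum>w'\<in>pverts G2. \<Sum>u'\<in>pverts G1. if u = u' then ?A2 w w' * x (u, w') else 0) +
      (\<Sum>u'\<in>pverts G1. \<Sum>w'\<in>pverts G2. if w = w' then ?A1 u u' * x (u', w) else 0)"
    unfolding sum.distrib by (rule arg_cong2[OF sum.swap refl])
  also have "\<dots> = mat_vec_on (pverts G2) ?A2 (\<lambda>w'. x (u, w')) w +
      mat_vec_on (pverts G1) ?A1 (\<lambda>u'. x (u', w)) u"
    using u w by (simp add: mat_vec_on_def fin)
  finally show ?thesis .
qed

lemma mat_vec_on_adjacency_path_graph:
  assumes "i \<in> {1..n}"
  shows "mat_vec_on (pverts (path_graph n)) (adjacency_matrix (path_graph n)) x i =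
    (if 1 < i then x (i - 1) else 0) + (if i < n then x (i + 1) else 0)"
proof -
  have "mat_vec_on (pverts (path_graph n)) (adjacency_matrix (path_graph n)) x i =
      (\<Sum>j=1..n. (if j = i - 1 then x (i - 1) else 0) + (if j = i + 1 then x (i + 1) else 0))"
    unfolding mat_vec_on_def using assms
    by (intro sum.cong) (auto simp: path_graph_def adjacency_matrix_def)
  then show ?thesis using assms by (auto simp: sum.distrib)
qed

section \<open>The ladder graph\<close>

lemma pverts_ladder: "pverts (ladder m) = {1, 2} \<times> {1..m}"
  by (auto simp: ladder_def cartesian_product_def path_graph_def)

lemma pair_graph_ladder: "pair_graph (ladder m)"
  unfolding ladder_def by (intro pair_graph_cartesian_product pair_graph_path_graph)

lemma connected_ladder:
  assumes "m \<ge> 1"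
  shows "connected (with_proj (ladder m))"
proof -
  interpret pair_graph "ladder m" by (rule pair_graph_ladder)
  show ?thesis
    unfolding connected_iff_strongly_connected unfolding ladder_def
    using assms by (intro strongly_connected_cartesian_product strongly_connected_path_graph) auto
qed

text \<open>
  The zero boundary values let the interior formula for the row sum hold at both ends of the
  ladder; \<open>3 - k\<close> is the opposite side of the ladder. The boundary values belong to the two sides \<open>y 1\<close> and \<open>y 2\<close>, not to \<open>x\<close>, because a vector indexed by the
  vertices has no meaningful coordinate at positions \<open>0\<close> and \<open>m + 1\<close>.
\<close>

lemma mat_vec_on_adjacency_ladder:
  assumes k: "k \<in> {1, 2}" and i: "i \<in> {1..m}"
    and x: "\<And>l j. l \<in> {1, 2} \<Longrightarrow> j \<in> {1..m} \<Longrightarrow> x (l, j) = y l j"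
    and bdry: "y k 0 = 0" "y k (m + 1) = 0"
  shows "mat_vec_on (pverts (ladder m)) (adjacency_matrix (ladder m)) x (k, i) =
    y k (i - 1) + y k (i + 1) + y (3 - k) i"
proof -
  have "mat_vec_on (pverts (ladder m)) (adjacency_matrix (ladder m)) x (k, i) =
      ((if 1 < i then x (k, i - 1) else 0) + (if i < m then x (k, i + 1) else 0)) +
      ((if 1 < k then x (k - 1, i) else 0) + (if k < 2 then x (k + 1, i) else 0))"
  proof -
    have "k \<in> pverts (path_graph 2)" "i \<in> pverts (path_graph m)" "k \<in> {1..2}"
      using k i by (auto simp: path_graph_def)
    then show ?thesis
      using i unfolding ladder_def
      by (simp only: mat_vec_on_adjacency_cartesian_product[OF pair_graph_path_graph
            pair_graph_path_graph] mat_vec_on_adjacency_path_graph)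
  qed
  moreover have "(if 1 < i then x (k, i - 1) else 0) = y k (i - 1)"
  proof (cases "1 < i")
    case True
    then have "i - 1 \<in> {1..m}" using i by auto
    then show ?thesis using k True by (simp add: x)
  next
    case False
    then have "i = 1" using i by simp
    then show ?thesis using bdry by simp
  qed
  moreover have "(if i < m then x (k, i + 1) else 0) = y k (i + 1)"
  proof (cases "i < m")
    case True
    then show ?thesis using k i by (simp add: x)
  next
    case False
    then have "i = m" using i by simp
    then show ?thesis using bdry by simp
  qed
  moreover have "(if 1 < k then x (k - 1, i) else 0) + (if k < 2 then x (k + 1, i) else 0) =
      y (3 - k) i"
    using k i by (auto simp: x numeral_2_eq_2 numeral_3_eq_3)
  ultimately show ?thesis by simp
qed

lemma vector_in_ladder_order:
  assumes "v \<in> pverts (ladder m)"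
  shows "vector_in_order (ladder_order m) (map f [1..<m + 1] @ map g [1..<m + 1]) v =
    (if fst v = 1 then f else g) (snd v)"
proof -
  let ?h = "\<lambda>v. (if fst v = (1::nat) then f else g) (snd v)"
  have "map f [1..<m + 1] @ map g [1..<m + 1] = map ?h (ladder_order m)"
    by (simp add: ladder_order_def comp_def del: upt_Suc)
  moreover have "v \<in> set (ladder_order m)"
    using assms by (auto simp: pverts_ladder ladder_order_def)
  ultimately show ?thesis
    by (simp add: vector_in_order_def map_of_zip_map)
qed

section \<open>Arithmetical structures from divisibility\<close>

theorem theorem3p21:
  fixes m :: nat and a b d1 d2 :: "nat \<Rightarrow> int" and d r :: "nat \<times> nat \<Rightarrow> int"
  assumes m: "m \<ge> 2"
    and a_pos: "\<And>i. i \<in> {1..m} \<Longrightarrow> a i > 0"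
    and b_pos: "\<And>i. i \<in> {1..m} \<Longrightarrow> b i > 0"
    and a_bdry: "a 0 = 0" "a (m + 1) = 0"
    and b_bdry: "b 0 = 0" "b (m + 1) = 0"
    and a_dvd: "\<And>i. i \<in> {1..m} \<Longrightarrow> a i dvd (a (i - 1) + a (i + 1) + b i)"
    and b_dvd: "\<And>i. i \<in> {1..m} \<Longrightarrow> b i dvd (b (i - 1) + b (i + 1) + a i)"
    and d1: "\<And>i. i \<in> {1..m} \<Longrightarrow> d1 i = (a (i - 1) + a (i + 1) + b i) div a i"
    and d2: "\<And>i. i \<in> {1..m} \<Longrightarrow> d2 i = (b (i - 1) + b (i + 1) + a i) div b i"
    and r: "r = vector_in_order (ladder_order m) (map a [1..<m + 1] @ map b [1..<m + 1])"
    and d: "d = vector_in_order (ladder_order m) (map d1 [1..<m + 1] @ map d2 [1..<m + 1])"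
    and prim: "primitive_on (pverts (ladder m)) r"
  shows "arithmetical_structure (ladder m) d r \<and>
    (\<forall>v\<in>pverts (ladder m).
       mat_vec_on (pverts (ladder m)) (diag_matrix d) r v =
       mat_vec_on (pverts (ladder m)) (adjacency_matrix (ladder m)) r v) \<and>
    (map a [1..<m + 1] \<noteq> map b [1..<m + 1] \<longrightarrow> nonsymmetric_structure m d r)"
proof -
  let ?V = "pverts (ladder m)"
  \<comment> \<open>Indexing both sides of the ladder by \<open>k\<close> treats the two divisibility hypotheses as one:
    the entry across the rung from \<open>y k i\<close> is \<open>y (3 - k) i\<close>.\<close>
  define y where "y k = (if k = (1::nat) then a else b)" for k
  define e where "e k = (if k = (1::nat) then d1 else d2)" for k
  have r_eq: "r (k, i) = y k i" and d_eq: "d (k, i) = e k i"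
    if "k \<in> {1, 2}" "i \<in> {1..m}" for k i
  proof -
    have v: "(k, i) \<in> ?V" using that by (simp add: pverts_ladder)
    show "r (k, i) = y k i" "d (k, i) = e k i"
      unfolding r d vector_in_ladder_order[OF v] by (simp_all add: y_def e_def)
  qed
  have y_pos: "y k i > 0" if "i \<in> {1..m}" for k i
    using that a_pos b_pos by (simp add: y_def)
  have y_nonneg: "y k i \<ge> 0" if "i \<le> m + 1" for k i
  proof -
    from that have "i = 0 \<or> i = m + 1 \<or> i \<in> {1..m}" by auto
    then show ?thesis
      using a_bdry b_bdry y_pos[of i k] by (auto simp: y_def)
  qed
  let ?s = "\<lambda>k i. y k (i - 1) + y k (i + 1) + y (3 - k) i"
  have s_dvd: "y k i dvd ?s k i" and e_eq: "e k i = ?s k i div y k i"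
    if "k \<in> {1, 2}" "i \<in> {1..m}" for k i
    using that a_dvd b_dvd d1 d2 by (auto simp: y_def e_def)
  have s_pos: "?s k i > 0" if "i \<in> {1..m}" for k i
    using that y_nonneg[of "i - 1" k] y_nonneg[of "i + 1" k] y_pos[of i "3 - k"] by fastforce
  have pos: "\<forall>v\<in>?V. d v > 0 \<and> r v > 0"
  proof
    fix v assume "v \<in> ?V"
    then obtain k i where v: "v = (k, i)" "k \<in> {1, 2}" "i \<in> {1..m}"
      by (auto simp: pverts_ladder)
    have "e k i > 0"
      using v s_dvd s_pos y_pos e_eq by (simp add: pos_imp_zdiv_pos_iff zdvd_imp_le)
    then show "d v > 0 \<and> r v > 0"
      using v y_pos by (simp add: r_eq d_eq)
  qed
  have eq: "\<forall>v\<in>?V. mat_vec_on ?V (diag_matrix d) r v = mat_vec_on ?V (adjacency_matrix (ladder m)) r v"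
  proof
    fix v assume v_in: "v \<in> ?V"
    then obtain k i where v: "v = (k, i)" "k \<in> {1, 2}" "i \<in> {1..m}"
      by (auto simp: pverts_ladder)
    have "mat_vec_on ?V (diag_matrix d) r v = d v * r v"
      using v_in by (intro mat_vec_on_diag) (simp_all add: pverts_ladder)
    also have "\<dots> = e k i * y k i" using v by (simp add: r_eq d_eq)
    also have "\<dots> = ?s k i" using v s_dvd by (simp add: e_eq)
    also have "\<dots> = mat_vec_on ?V (adjacency_matrix (ladder m)) r v"
      unfolding v(1) using v a_bdry b_bdry
      by (intro mat_vec_on_adjacency_ladder[symmetric] r_eq) (auto simp: y_def)
    finally show "mat_vec_on ?V (diag_matrix d) r v = mat_vec_on ?V (adjacency_matrix (ladder m)) r v" .
  qed
  have struct: "arithmetical_structure (ladder m) d r"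
    unfolding arithmetical_structure_def mat_vec_on_diff
    using pair_graph_ladder connected_ladder m pos prim eq by auto
  have "nonsymmetric_structure m d r" if "map a [1..<m + 1] \<noteq> map b [1..<m + 1]"
  proof -
    from that obtain i where "i \<in> {1..m}" "a i \<noteq> b i"
      by (auto simp: less_Suc_eq_le simp del: upt_Suc)
    then have "i \<in> {1..m}" "r (1, i) \<noteq> r (2, i)" by (simp_all add: r_eq y_def)
    then show ?thesis
      using struct unfolding nonsymmetric_structure_def symmetric_structure_def by blast
  qed
  with struct eq show ?thesis by blast
qed

end
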